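(* Let $V=\bigotimes_{i=1}^d V^{(i)}$ be the Hilbert tensor product of real Hilbert spaces $V^{(1)},\dots,V^{(d)}$, with norm $\|\cdot\|_V$. Let $a:V\times V\to\mathbb R$ be a bilinear form for which there are constants $c_0,c_1>0$ with $|a(u,v)|\le c_1\|u\|_V\|v\|_V$ for all $u,v\in V$ and $a(v,v)\ge c_0\|v\|_V^2$ for all $v\in V$, and let $\ell\in V^*$ be a bounded linear functional. Fix $r\in\mathbb N$ and fixed subatoms $\psi_i^{(j)}\in V^{(i)}$ ($1\le i\le d$, $1\le j\le r$), and let $\mathcal F_r\subset V$ be the associated rank-$r$ CP trial space. Then the Galerkin problem $$\text{find } u_r\in\mathcal F_r\ \text{ such that }\ a(u_r,v_r)=\ell(v_r)\quad\forall v_r\in\mathcal F_r$$ admits a unique solution $u_r\in\mathcal F_r$.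
   Context: Each $V^{(i)}$ is a Hilbert space of functions of the $i$-th coordinate (the coordinates range over space, time and parameters), and the elementary tensor $\psi_1\otimes\cdots\otimes\psi_d$ is identified with the product function $x\mapsto\prod_{i=1}^d\psi_i(x_i)$. For fixed subatoms $\psi_i^{(j)}$, the rank-$r$ canonical polyadic (CP) trial space is the finite-dimensional linear subspace $$\mathcal F_r=\left\{\sum_{j=1}^r c^{(j)}\,\psi_1^{(j)}\otimes\cdots\otimes\psi_d^{(j)}\;:\;c^{(j)}\in\mathbb R\right\}\subset V.$$ *)

theory Defs
  imports "HOL-Analysis.Analysis"
begin

text \<open>
  A real Hilbert space given by a carrier inside a real vector space and an inner product of its
  own, which is constrained on the carrier only. Unlike the class \<^class>\<open>real_inner\<close>, this allows
  a family of different Hilbert spaces indexed by a number. The common ambient vector space is no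
  restriction: any family of vector spaces embeds into its direct sum.
\<close>

locale real_hilbert_space =
  fixes S :: "'h::real_vector set" and ip :: "'h \<Rightarrow> 'h \<Rightarrow> real"
  assumes carrier_subspace: "subspace S"
    and ip_commute: "\<lbrakk>x \<in> S; y \<in> S\<rbrakk> \<Longrightarrow> ip x y = ip y x"
    and ip_add_left: "\<lbrakk>x \<in> S; y \<in> S; z \<in> S\<rbrakk> \<Longrightarrow> ip (x + y) z = ip x z + ip y z"
    and ip_scaleR_left: "\<lbrakk>x \<in> S; y \<in> S\<rbrakk> \<Longrightarrow> ip (c *\<^sub>R x) y = c * ip x y"
    and ip_ge_zero: "x \<in> S \<Longrightarrow> 0 \<le> ip x x"
    and ip_eq_zero_iff: "x \<in> S \<Longrightarrow> ip x x = 0 \<longleftrightarrow> x = 0"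
    and cauchy_complete:
      "\<lbrakk>\<And>n. X n \<in> S;
        \<And>e. 0 < e \<Longrightarrow> \<exists>N. \<forall>m\<ge>N. \<forall>n\<ge>N. sqrt (ip (X m - X n) (X m - X n)) < e\<rbrakk>
       \<Longrightarrow> \<exists>x\<in>S. (\<lambda>n. sqrt (ip (X n - x) (X n - x))) \<longlonglongrightarrow> 0"

text \<open>
  The Hilbert space \<^typ>\<open>'v\<close>, together with the map \<open>tensor\<close> sending a family
  \<open>x\<^sub>1, \<dots>, x\<^sub>d\<close> to \<open>x\<^sub>1 \<otimes> \<dots> \<otimes> x\<^sub>d\<close>, is a Hilbert tensor product of \<open>V 1, \<dots>, V d\<close>:
  the tensor map is multilinear, inner products of elementary tensors are the products of
  the inner products of the factors, and elementary tensors span a dense subspace. This determines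
  \<^typ>\<open>'v\<close> and \<open>tensor\<close> up to a unique isometric isomorphism, so it includes every
  concrete realization, for instance the one where \<open>tensor \<psi>\<close> is the product function
  \<open>\<lambda>x. \<Prod>i = 1..d. \<psi> i (x i)\<close>.
\<close>

locale hilbert_tensor_product =
  fixes d :: nat
    and V :: "nat \<Rightarrow> 'h::real_vector set"
    and ip :: "nat \<Rightarrow> 'h \<Rightarrow> 'h \<Rightarrow> real"
    and tensor :: "(nat \<Rightarrow> 'h) \<Rightarrow> 'v::{real_inner, complete_space}"
  assumes factor: "i \<in> {1..d} \<Longrightarrow> real_hilbert_space (V i) (ip i)"
    and tensor_add:
      "\<lbrakk>x \<in> Pi {1..d} V; i \<in> {1..d}; u \<in> V i; v \<in> V i\<rbrakk>
       \<Longrightarrow> tensor (x(i := u + v)) = tensor (x(i := u)) + tensor (x(i := v))"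
    and tensor_scaleR:
      "\<lbrakk>x \<in> Pi {1..d} V; i \<in> {1..d}; u \<in> V i\<rbrakk>
       \<Longrightarrow> tensor (x(i := c *\<^sub>R u)) = c *\<^sub>R tensor (x(i := u))"
    and inner_tensor:
      "\<lbrakk>x \<in> Pi {1..d} V; y \<in> Pi {1..d} V\<rbrakk>
       \<Longrightarrow> inner (tensor x) (tensor y) = (\<Prod>i = 1..d. ip i (x i) (y i))"
    and tensor_dense: "closure (span (tensor ` Pi {1..d} V)) = UNIV"

definition cp_trial_space ::
  "((nat \<Rightarrow> 'h) \<Rightarrow> 'v::real_vector) \<Rightarrow> nat \<Rightarrow> (nat \<Rightarrow> nat \<Rightarrow> 'h) \<Rightarrow> 'v set" where
  "cp_trial_space tensor r \<psi> =
     {\<Sum>j = 1..r. c j *\<^sub>R tensor (\<lambda>i. \<psi> i j) | c :: nat \<Rightarrow> real. True}"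

end

theory Submission
  imports Defs
begin

text \<open>
  The trial space is the span of finitely many vectors. On such a span, coercivity makes the Galerkin
  problem uniquely solvable by Gram--Schmidt orthogonalization with respect to the possibly
  nonsymmetric form, adding one spanning vector at a time.
\<close>

lemma positive_definite_solution_on_span:
  fixes a :: "'v::real_vector \<Rightarrow> 'v \<Rightarrow> real"
  assumes "bilinear a" and pos: "\<And>v. v \<noteq> 0 \<Longrightarrow> 0 < a v v"
    and "finite B" and "linear l"
  shows "\<exists>u\<in>span B. \<forall>v\<in>span B. a u v = l v"
  using \<open>finite B\<close> \<open>linear l\<close>
\<comment> \<open>\<open>l\<close> is generalized because the induction step solves two problems on
  \<open>span B\<close>: one for \<open>l\<close> and one for the functional
  \<open>a w\<close>.\<close>
proof (induction B arbitrary: l rule: finite_induct)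
  case empty
  then show ?case
    using bilinear_rzero[OF \<open>bilinear a\<close>] by (simp add: linear_0)
next
  case (insert w B)
  have lin: "linear (a x)" for x
    using \<open>bilinear a\<close> by (simp add: bilinear_def)
  obtain u where u: "u \<in> span B" "\<And>v. v \<in> span B \<Longrightarrow> a u v = l v"
    using insert.IH[OF \<open>linear l\<close>] by blast
  \<comment> \<open>\<open>p\<close> is the projection of \<open>w\<close> onto
    \<open>span B\<close> along \<open>a\<close>: the residual \<open>w - p\<close>, placed in the
    first argument, annihilates \<open>span B\<close>. Without symmetry of \<open>a\<close> this
    orthogonality is only one-sided.\<close>
  obtain p where p: "p \<in> span B" "\<And>v. v \<in> span B \<Longrightarrow> a p v = a w v"
    using insert.IH[OF lin] by blast
  show ?case
  \<comment> \<open>If \<open>w = p\<close>, then \<open>w\<close> already lies in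
    \<open>span B\<close>, so the span does not grow and \<open>u\<close> still solves the problem.
    Otherwise the residual is nonzero, which is what positivity requires.\<close>
  proof (cases "w = p")
    case True
    then show ?thesis
      using u p(1) by (auto simp: span_redundant)
  next
    case False
    define q where "q = w - p"
    have q_orth: "a q v = 0" if "v \<in> span B" for v
      using p(2)[OF that] by (simp add: q_def bilinear_lsub[OF \<open>bilinear a\<close>])
    \<comment> \<open>Expanding the second argument \<open>q = w - p\<close> leaves
      \<open>a q w\<close>, since \<open>a q p = 0\<close>. Positivity at \<open>q\<close> then
      makes the divisor in \<open>k\<close> nonzero.\<close>
    have "a q q = a q w"
      using q_orth[OF p(1)] linear_diff[OF lin, of q w p] by (simp add: q_def)
    with pos[of q] False have qw: "a q w \<noteq> 0"
      by (simp add: q_def)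
    \<comment> \<open>\<open>k\<close> solves \<open>a u w + k * a q w = l w\<close>. Adding
      \<open>k *\<^sub>R q\<close> to \<open>u\<close> repairs the equation at \<open>w\<close> and
      leaves those on \<open>span B\<close> intact.\<close>
    define k where "k = (l w - a u w) / a q w"
    have a_eq: "a (u + k *\<^sub>R q) v = a u v + k * a q v" for v
      using \<open>bilinear a\<close> by (simp add: bilinear_ladd bilinear_lmul)
    have on_B: "a (u + k *\<^sub>R q) v = l v" if "v \<in> insert w B" for v
      using that u(2) q_orth qw unfolding a_eq by (auto simp: k_def span_base)
    have sub: "span B \<subseteq> span (insert w B)"
      by (intro span_mono) auto
    have "u + k *\<^sub>R q \<in> span (insert w B)"
      using u(1) p(1) sub unfolding q_def
      by (intro span_add span_scale span_diff) (auto intro: span_base)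
    then show ?thesis
      using linear_eq_on_span[OF lin \<open>linear l\<close> on_B] by blast
  qed
qed

lemma ex1_solution_on_span:
  fixes a :: "'v::real_vector \<Rightarrow> 'v \<Rightarrow> real"
  assumes "bilinear a" and pos: "\<And>v. v \<noteq> 0 \<Longrightarrow> 0 < a v v"
    and "finite B" and "linear l"
  shows "\<exists>!u. u \<in> span B \<and> (\<forall>v\<in>span B. a u v = l v)"
proof (rule ex_ex1I)
  show "\<exists>u. u \<in> span B \<and> (\<forall>v\<in>span B. a u v = l v)"
    using positive_definite_solution_on_span[OF assms] by blast
next
  fix u u'
  assume "u \<in> span B \<and> (\<forall>v\<in>span B. a u v = l v)"
    and "u' \<in> span B \<and> (\<forall>v\<in>span B. a u' v = l v)"
  \<comment> \<open>The difference of two solutions lies in the span, so it is itself an admissible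
    test vector, and both solutions give the same value there.\<close>
  then have "a (u - u') (u - u') = 0"
    by (simp add: bilinear_lsub[OF \<open>bilinear a\<close>] span_diff)
  with pos[of "u - u'"] show "u = u'"
    by auto
qed

text \<open>Links the trial space, whose coefficients are attached to indices, with spans of sets of
  vectors. \<open>t\<close> may take the same value at several indices; the argument by minimality
  of the span covers this case as well.\<close>

lemma span_image_eq_sums:
  fixes t :: "'i \<Rightarrow> 'v::real_vector"
  assumes "finite I"
  shows "span (t ` I) = {\<Sum>j\<in>I. c j *\<^sub>R t j | c. True}" (is "_ = ?S")
proof
  show "?S \<subseteq> span (t ` I)"
    by (auto intro!: span_sum span_scale intro: span_base)
  have "t i \<in> ?S" if "i \<in> I" for i
    using assms that by (auto intro!: exI[of _ "\<lambda>j. if j = i then 1 else 0"]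
        simp: if_distrib[of "\<lambda>x. x *\<^sub>R _"] cong: if_cong)
  moreover have "subspace ?S"
    unfolding subspace_def
  proof (intro conjI ballI allI)
    show "0 \<in> ?S"
      by (auto intro!: exI[of _ "\<lambda>_. 0"])
  next
    fix x y assume "x \<in> ?S" "y \<in> ?S"
    then obtain c e where "x = (\<Sum>j\<in>I. c j *\<^sub>R t j)" "y = (\<Sum>j\<in>I. e j *\<^sub>R t j)"
      by blast
    then have "x + y = (\<Sum>j\<in>I. (c j + e j) *\<^sub>R t j)"
      by (simp add: scaleR_add_left sum.distrib)
    then show "x + y \<in> ?S"
      by (auto intro!: exI[of _ "\<lambda>j. c j + e j"])
  next
    fix k x assume "x \<in> ?S"
    then obtain c where "x = (\<Sum>j\<in>I. c j *\<^sub>R t j)"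
      by blast
    then have "k *\<^sub>R x = (\<Sum>j\<in>I. (k * c j) *\<^sub>R t j)"
      by (simp add: scaleR_sum_right)
    then show "k *\<^sub>R x \<in> ?S"
      by (auto intro!: exI[of _ "\<lambda>j. k * c j"])
  qed
  ultimately show "span (t ` I) \<subseteq> ?S"
    by (intro span_minimal) auto
qed

theorem theorem2:
  fixes d r :: nat
    and V :: "nat \<Rightarrow> 'h::real_vector set"
    and ip :: "nat \<Rightarrow> 'h \<Rightarrow> 'h \<Rightarrow> real"
    and tensor :: "(nat \<Rightarrow> 'h) \<Rightarrow> 'v::{real_inner, complete_space}"
    and a :: "'v \<Rightarrow> 'v \<Rightarrow> real"
    and l :: "'v \<Rightarrow> real"
    and c0 c1 :: real
    and \<psi> :: "nat \<Rightarrow> nat \<Rightarrow> 'h"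
  assumes "hilbert_tensor_product d V ip tensor"
    and "bilinear a"
    and "0 < c0" and "0 < c1"
    and "\<And>u v. \<bar>a u v\<bar> \<le> c1 * norm u * norm v"
    and "\<And>v. a v v \<ge> c0 * (norm v)\<^sup>2"
    and "bounded_linear l"
    and "\<And>i j. i \<in> {1..d} \<Longrightarrow> j \<in> {1..r} \<Longrightarrow> \<psi> i j \<in> V i"
  shows "\<exists>!u. u \<in> cp_trial_space tensor r \<psi> \<and> (\<forall>v\<in>cp_trial_space tensor r \<psi>. a u v = l v)"
proof -
  \<comment> \<open>Coercivity enters only through this strict positivity, the trial space being
    spanned by finitely many elementary tensors.\<close>
  have "0 < a v v" if "v \<noteq> 0" for v
    using assms(6)[of v] \<open>0 < c0\<close> that
    by (smt (verit) mult_pos_pos zero_less_norm_iff zero_less_power)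
  moreover have "cp_trial_space tensor r \<psi> = span ((\<lambda>j. tensor (\<lambda>i. \<psi> i j)) ` {1..r})"
    by (simp add: cp_trial_space_def span_image_eq_sums)
  ultimately show ?thesis
    using ex1_solution_on_span[OF \<open>bilinear a\<close>] bounded_linear.linear[OF \<open>bounded_linear l\<close>]
    by simp
qed

end
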